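(* Let $\hat{\mathbf x}_1,\hat{\mathbf x}_2,\hat{\mathbf x}_3,\hat{\mathbf x}_4,\hat{\mathbf x}_5$ be five finite points of $\mathrm P\mathbb R^2$ in general position, and let $\boldsymbol\xi_1,\boldsymbol\xi_2,\boldsymbol\xi_3$ be the vertices of the diagonal triangle of the quadrangle $\hat{\mathbf x}_1\hat{\mathbf x}_2\hat{\mathbf x}_3\hat{\mathbf x}_4$. Put $(\beta_1,\beta_2,\beta_3)^T=[\boldsymbol\xi_{123}]^{-1}\hat{\mathbf x}_5$. Then $$\mathbf C=[\boldsymbol\xi_{123}]^{-T}\,\mathrm{Diag}\bigl(\beta_3^2-\beta_2^2,\ \beta_1^2-\beta_3^2,\ \beta_2^2-\beta_1^2\bigr)\,[\boldsymbol\xi_{123}]^{-1}$$ is the unique (up to scale) non-degenerate conic such that $\hat{\mathbf x}_i^T\mathbf C\hat{\mathbf x}_i=0$ for $i=1,2,3,4,5$.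
   Context: $\mathrm P\mathbb R^2$ is the real projective plane. A hat denotes a finite point in normalized homogeneous coordinates, i.e. a vector of $\mathbb R^3$ whose third component is $1$. Five points are in general position if no three of them are collinear. The vertices of the diagonal triangle are always taken to be the vectors $\boldsymbol\xi_1=(\hat{\mathbf x}_1\times\hat{\mathbf x}_2)\times(\hat{\mathbf x}_3\times\hat{\mathbf x}_4)$, $\boldsymbol\xi_2=(\hat{\mathbf x}_1\times\hat{\mathbf x}_3)\times(\hat{\mathbf x}_2\times\hat{\mathbf x}_4)$, $\boldsymbol\xi_3=(\hat{\mathbf x}_1\times\hat{\mathbf x}_4)\times(\hat{\mathbf x}_2\times\hat{\mathbf x}_3)$, where $\times$ is the cross product. $[\boldsymbol\xi_{123}]$ is the $3\times3$ matrix with columns $\boldsymbol\xi_1,\boldsymbol\xi_2,\boldsymbol\xi_3$, and $[\cdot]^{-T}$ is the inverse transpose. A conic is a nonzero symmetric $3\times3$ matrix up to nonzero scale; it is non-degenerate if its determinant is nonzero. *)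

theory Defs
  imports "HOL-Analysis.Analysis"
begin

unbundle cross3_syntax

text \<open>Points and lines of the real projective plane are given by (nonzero) homogeneous
  coordinate vectors in \<open>real^3\<close>. Collinearity is incidence with a common projective line;
  the library's \<open>collinear\<close> is affine collinearity in \<open>real^3\<close>, a different relation on
  arbitrary homogeneous vectors.\<close>

definition finite_point :: "real^3 \<Rightarrow> bool" where
  "finite_point x \<longleftrightarrow> x $ 3 = 1"

definition proj_collinear :: "(real^3) set \<Rightarrow> bool" where
  "proj_collinear S \<longleftrightarrow> (\<exists>l. l \<noteq> 0 \<and> (\<forall>x\<in>S. l \<bullet> x = 0))"

definition general_position :: "(nat \<Rightarrow> real^3) \<Rightarrow> nat set \<Rightarrow> bool" where
  "general_position x I \<longleftrightarrow>
     (\<forall>i\<in>I. \<forall>j\<in>I. \<forall>k\<in>I. i \<noteq> j \<and> i \<noteq> k \<and> j \<noteq> k \<longrightarrow> \<not> proj_collinear {x i, x j, x k})"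

definition mat_of_cols3 :: "real^3 \<Rightarrow> real^3 \<Rightarrow> real^3 \<Rightarrow> real^3^3" where
  "mat_of_cols3 a b c = transpose (vector [a, b, c])"

definition Diag3 :: "real \<Rightarrow> real \<Rightarrow> real \<Rightarrow> real^3^3" where
  "Diag3 a b c = vector [vector [a, 0, 0], vector [0, b, 0], vector [0, 0, c]]"

text \<open>A conic is represented by a nonzero symmetric matrix; two matrices represent the same
  conic if they agree up to a nonzero factor.\<close>

definition is_conic :: "real^3^3 \<Rightarrow> bool" where
  "is_conic A \<longleftrightarrow> A \<noteq> 0 \<and> transpose A = A"

definition same_conic :: "real^3^3 \<Rightarrow> real^3^3 \<Rightarrow> bool" where
  "same_conic A B \<longleftrightarrow> (\<exists>k. k \<noteq> 0 \<and> A = k *\<^sub>R B)"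

definition nondegenerate :: "real^3^3 \<Rightarrow> bool" where
  "nondegenerate A \<longleftrightarrow> det A \<noteq> 0"

definition on_conic :: "real^3 \<Rightarrow> real^3^3 \<Rightarrow> bool" where
  "on_conic x A \<longleftrightarrow> x \<bullet> (A *v x) = 0"

end

theory Submission
  imports Defs
begin

text \<open>The diagonal triangle of a quadrangle is the coordinate system in which the quadrangle
  becomes as symmetric as possible. Up to a factor, the four points have the coordinates
  \<open>(1,1,1)\<close>, \<open>(1,-1,1)\<close>, \<open>(1,1,-1)\<close> and \<open>(1,-1,-1)\<close> with respect to the basis \<open>\<xi>\<^sub>1, \<xi>\<^sub>2, \<xi>\<^sub>3\<close>:
  each of the four signed sums of the \<open>\<xi>\<^sub>i\<close> is twice a bracket times one of the points
  (lemma \<open>diagonal_signed_sums\<close>), and the bracket is nonzero because three points of the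
  quadrangle are never collinear.

  A quadratic form is transported to these coordinates by \<open>A \<mapsto> \<Xi>\<^sup>T A \<Xi>\<close>. A form that
  vanishes at all four sign vectors has no mixed terms, and its diagonal has sum zero. If it also
  vanishes at \<open>\<beta>\<close>, the coordinate vector of the fifth point, then its diagonal is orthogonal
  both to \<open>(1,1,1)\<close> and to \<open>(\<beta>\<^sub>1\<^sup>2,\<beta>\<^sub>2\<^sup>2,\<beta>\<^sub>3\<^sup>2)\<close>, hence a multiple of the cross product of these two
  vectors, which is the diagonal in the formula for \<open>C\<close> (lemma
  \<open>vanishes_at_signs_and_point_iff\<close>). The entries of that cross product are the differences
  \<open>\<beta>\<^sub>i\<^sup>2 - \<beta>\<^sub>j\<^sup>2\<close>. The six equations \<open>\<beta>\<^sub>i = \<plusminus>\<beta>\<^sub>j\<close> are the equations of the six sides of the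
  quadrangle, so general position of the fifth point makes all the entries nonzero
  (lemma \<open>squared_coordinates_distinct\<close>). This gives both the non-degeneracy of \<open>C\<close> and its
  uniqueness up to scale.\<close>

section \<open>Collinearity as linear dependence\<close>

lemma proj_collinear_if_singular:
  assumes "\<not> invertible (vector [a, b, c] :: real^3^3)"
  shows "proj_collinear {a, b, c}"
proof -
  let ?M = "vector [a, b, c] :: real^3^3"
  have "\<not> (\<exists>B. B ** ?M = mat 1)"
    using assms by (simp add: invertible_left_inverse)
  then obtain l where l: "?M *v l = 0" "l \<noteq> 0"
    by (auto simp: matrix_left_invertible_ker)
  from l(1) have "a \<bullet> l = 0" "b \<bullet> l = 0" "c \<bullet> l = 0"
    by (auto simp: vec_eq_iff forall_3 matrix_vector_mul_component vector_3)
  with l(2) show ?thesis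
    unfolding proj_collinear_def by (auto simp: inner_commute)
qed

lemma bracket_nonzero_if_not_collinear:
  "\<not> proj_collinear {a, b, c} \<Longrightarrow> a \<bullet> (b \<times> c) \<noteq> 0"
  using proj_collinear_if_singular[of a b c] by (auto simp: invertible_det_nz dot_cross_det)

lemma proj_collinear_if_multiple_in_span:
  assumes "k *\<^sub>R w = s *\<^sub>R u + t *\<^sub>R v" and "k \<noteq> 0"
  shows "proj_collinear {w, u, v}"
proof (rule ccontr)
  assume "\<not> proj_collinear {w, u, v}"
  then have "w \<bullet> (u \<times> v) \<noteq> 0"
    by (rule bracket_nonzero_if_not_collinear)
  moreover have "k * (w \<bullet> (u \<times> v)) = (k *\<^sub>R w) \<bullet> (u \<times> v)"
    by simp
  then have "k * (w \<bullet> (u \<times> v)) = 0"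
    unfolding assms(1) by (simp add: inner_add_left dot_cross_self)
  ultimately show False
    using assms(2) by simp
qed

lemma mat_of_cols3_mult:
  "mat_of_cols3 a b c *v y = y$1 *\<^sub>R a + y$2 *\<^sub>R b + y$3 *\<^sub>R c"
  by (simp add: mat_of_cols3_def vec_eq_iff matrix_vector_mult_def transpose_def sum_3 vector_3
      algebra_simps)

section \<open>Coordinates with respect to the diagonal triangle\<close>

text \<open>Four vectors of a three-dimensional space satisfy a linear relation whose coefficients are the
  brackets of the triples. It provides multiples \<open>p, q, r, s\<close> of \<open>c, d, a, b\<close> that add up to zero.
  The formula for \<open>(a \<times> b) \<times> (c \<times> d)\<close> turns the three vertices into \<open>p + q\<close>, \<open>p + r\<close> and
  \<open>p + s\<close>, so that the signed sums are \<open>2p\<close>, \<open>- 2r\<close>, \<open>- 2s\<close> and \<open>2q\<close>.\<close>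

lemma diagonal_signed_sums:
  fixes a b c d :: "real^3"
  defines "e1 \<equiv> (a \<times> b) \<times> (c \<times> d)"
    and "e2 \<equiv> (a \<times> c) \<times> (b \<times> d)"
    and "e3 \<equiv> (a \<times> d) \<times> (b \<times> c)"
  shows "e1 + e2 + e3 = (2 * (a \<bullet> (b \<times> d))) *\<^sub>R c"
    and "e1 - e2 + e3 = (- 2 * (b \<bullet> (c \<times> d))) *\<^sub>R a"
    and "e1 + e2 - e3 = (2 * (a \<bullet> (c \<times> d))) *\<^sub>R b"
    and "e1 - e2 - e3 = (- 2 * (a \<bullet> (b \<times> c))) *\<^sub>R d"
proof -
  have swap: "a \<bullet> (d \<times> c) = - (a \<bullet> (c \<times> d))" "a \<bullet> (c \<times> b) = - (a \<bullet> (b \<times> c))"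
    "a \<bullet> (d \<times> b) = - (a \<bullet> (b \<times> d))"
    by (simp_all add: cross_skew[of d] cross_skew[of c b])
  have e1: "e1 = (a \<bullet> (b \<times> d)) *\<^sub>R c - (a \<bullet> (b \<times> c)) *\<^sub>R d"
    and e2: "e2 = (a \<bullet> (c \<times> d)) *\<^sub>R b + (a \<bullet> (b \<times> c)) *\<^sub>R d"
    and e3: "e3 = - (a \<bullet> (c \<times> d)) *\<^sub>R b + (a \<bullet> (b \<times> d)) *\<^sub>R c"
    by (simp_all add: e1_def e2_def e3_def cross_cross_det swap flip: dot_cross_det)
  show "e1 + e2 + e3 = (2 * (a \<bullet> (b \<times> d))) *\<^sub>R c"
    and "e1 + e2 - e3 = (2 * (a \<bullet> (c \<times> d))) *\<^sub>R b"
    and "e1 - e2 - e3 = (- 2 * (a \<bullet> (b \<times> c))) *\<^sub>R d"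
    by (simp_all add: e1 e2 e3 vec_eq_iff algebra_simps)
  (* The remaining sum is the only one that needs the relation between all four vectors: expanding
     the first product with its factors exchanged gives a multiple of a in place of c and d. *)
  have "e1 = - ((c \<times> d) \<times> (a \<times> b))"
    unfolding e1_def by (rule cross_skew)
  also have "\<dots> = (c \<bullet> (d \<times> a)) *\<^sub>R b - (c \<bullet> (d \<times> b)) *\<^sub>R a"
    by (simp add: cross_cross_det flip: dot_cross_det)
  also have "c \<bullet> (d \<times> a) = a \<bullet> (c \<times> d)"
    by (metis cross_triple inner_commute)
  also have "c \<bullet> (d \<times> b) = b \<bullet> (c \<times> d)"
    by (metis cross_triple inner_commute)
  finally have e1': "e1 = (a \<bullet> (c \<times> d)) *\<^sub>R b - (b \<bullet> (c \<times> d)) *\<^sub>R a" .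
  have "e1 - e2 + e3 = 2 *\<^sub>R e1 - (e1 + e2 - e3)"
    by (simp add: scaleR_2)
  also have "\<dots> = (- 2 * (b \<bullet> (c \<times> d))) *\<^sub>R a"
    unfolding \<open>e1 + e2 - e3 = _\<close>
    unfolding e1'
    by (simp add: vec_eq_iff algebra_simps)
  finally show "e1 - e2 + e3 = (- 2 * (b \<bullet> (c \<times> d))) *\<^sub>R a" .
qed

text \<open>A line through all three vertices \<open>\<xi>\<^sub>i\<close> would contain their signed sums, that is, the points
  of the quadrangle.\<close>

lemma diagonal_triangle_invertible:
  fixes a b c d :: "real^3"
  assumes "\<not> proj_collinear {a, b, c}" "\<not> proj_collinear {a, b, d}"
    "\<not> proj_collinear {a, c, d}" "\<not> proj_collinear {b, c, d}"
  shows "invertible (mat_of_cols3 ((a \<times> b) \<times> (c \<times> d)) ((a \<times> c) \<times> (b \<times> d)) ((a \<times> d) \<times> (b \<times> c)))"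
    (is "invertible (mat_of_cols3 ?e1 ?e2 ?e3)")
proof (rule ccontr)
  assume "\<not> ?thesis"
  then have "\<not> invertible (vector [?e1, ?e2, ?e3] :: real^3^3)"
    by (simp add: mat_of_cols3_def invertible_det_nz)
  then have "proj_collinear {?e1, ?e2, ?e3}"
    by (rule proj_collinear_if_singular)
  then obtain l where l: "l \<noteq> 0" "l \<bullet> ?e1 = 0" "l \<bullet> ?e2 = 0" "l \<bullet> ?e3 = 0"
    by (auto simp: proj_collinear_def)
  have "l \<bullet> (?e1 + ?e2 + ?e3) = 0" "l \<bullet> (?e1 - ?e2 + ?e3) = 0" "l \<bullet> (?e1 + ?e2 - ?e3) = 0"
    by (simp_all add: inner_add_right inner_diff_right l)
  then have "l \<bullet> c = 0" "l \<bullet> a = 0" "l \<bullet> b = 0"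
    unfolding diagonal_signed_sums using assms[THEN bracket_nonzero_if_not_collinear] by simp_all
  with l(1) assms(1) show False
    by (auto simp: proj_collinear_def)
qed

text \<open>The equation \<open>y$i = y$j\<close> or \<open>y$i = - y$j\<close> holds at exactly two of the four sign vectors (up
  to sign), so it describes the line through the corresponding two points. In each case below,
  the vector with coordinates \<open>2y\<close> is written as a combination of those two signed sums.\<close>

lemma squared_coordinates_distinct:
  fixes a b c d w y :: "real^3"
  defines "E \<equiv> mat_of_cols3 ((a \<times> b) \<times> (c \<times> d)) ((a \<times> c) \<times> (b \<times> d)) ((a \<times> d) \<times> (b \<times> c))"
  assumes w: "w = E *v y"
    and ncol: "\<not> proj_collinear {w, a, b}" "\<not> proj_collinear {w, a, c}"
      "\<not> proj_collinear {w, a, d}" "\<not> proj_collinear {w, b, c}"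
      "\<not> proj_collinear {w, b, d}" "\<not> proj_collinear {w, c, d}"
  shows "(y$1)\<^sup>2 \<noteq> (y$2)\<^sup>2" "(y$1)\<^sup>2 \<noteq> (y$3)\<^sup>2" "(y$2)\<^sup>2 \<noteq> (y$3)\<^sup>2"
proof -
  define e1 e2 e3 where e: "e1 = (a \<times> b) \<times> (c \<times> d)" "e2 = (a \<times> c) \<times> (b \<times> d)"
    "e3 = (a \<times> d) \<times> (b \<times> c)"
  have w': "w = y$1 *\<^sub>R e1 + y$2 *\<^sub>R e2 + y$3 *\<^sub>R e3"
    unfolding w E_def e by (rule mat_of_cols3_mult)
  note sums = diagonal_signed_sums[of a b c d, folded e]
  have on_side: "proj_collinear {w, u, v}"
    if "2 *\<^sub>R w = s *\<^sub>R f + t *\<^sub>R g" "f = p *\<^sub>R u" "g = q *\<^sub>R v" for f g u v s t p q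
    using proj_collinear_if_multiple_in_span[of 2 w "s * p" u "t * q" v] that by simp
  have "y$2 \<noteq> y$3"
    using on_side[OF _ sums(1,4), of "y$1 + y$2" "y$1 - y$2"] ncol(6)
    by (auto simp: w' vec_eq_iff algebra_simps)
  moreover have "y$2 \<noteq> - y$3"
    using on_side[OF _ sums(2,3), of "y$1 - y$2" "y$1 + y$2"] ncol(1)
    by (auto simp: w' vec_eq_iff algebra_simps)
  ultimately show "(y$2)\<^sup>2 \<noteq> (y$3)\<^sup>2"
    by (simp add: power2_eq_iff)
  have "y$1 \<noteq> y$3"
    using on_side[OF _ sums(2,1), of "y$1 - y$2" "y$1 + y$2"] ncol(2)
    by (auto simp: w' vec_eq_iff algebra_simps)
  moreover have "y$1 \<noteq> - y$3"
    using on_side[OF _ sums(3,4), of "y$1 + y$2" "y$1 - y$2"] ncol(5)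
    by (auto simp: w' vec_eq_iff algebra_simps)
  ultimately show "(y$1)\<^sup>2 \<noteq> (y$3)\<^sup>2"
    by (simp add: power2_eq_iff)
  have "y$1 \<noteq> y$2"
    using on_side[OF _ sums(3,1), of "y$1 - y$3" "y$1 + y$3"] ncol(4)
    by (auto simp: w' vec_eq_iff algebra_simps)
  moreover have "y$1 \<noteq> - y$2"
    using on_side[OF _ sums(2,4), of "y$1 + y$3" "y$1 - y$3"] ncol(3)
    by (auto simp: w' vec_eq_iff algebra_simps)
  ultimately show "(y$1)\<^sup>2 \<noteq> (y$2)\<^sup>2"
    by (simp add: power2_eq_iff)
qed

section \<open>Conics in diagonal coordinates\<close>

lemma on_conic_scale:
  "k \<noteq> 0 \<Longrightarrow> on_conic (k *\<^sub>R x) A \<longleftrightarrow> on_conic x A"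
  by (simp add: on_conic_def matrix_vector_mult_scaleR)

lemma on_conic_pullback:
  "on_conic (P *v y) A \<longleftrightarrow> on_conic y (transpose P ** A ** P)"
proof -
  have "y \<bullet> ((transpose P ** A ** P) *v y) = y \<bullet> (transpose P *v (A *v (P *v y)))"
    by (simp add: matrix_vector_mul_assoc matrix_mul_assoc)
  also have "\<dots> = (P *v y) \<bullet> (A *v (P *v y))"
    by (metis dot_lmul_matrix transpose_matrix_vector inner_commute)
  finally show ?thesis
    by (simp add: on_conic_def)
qed

lemma det_Diag3: "det (Diag3 p q r) = p * q * r"
  by (simp add: Diag3_def det_3 vector_3)

lemma transpose_Diag3: "transpose (Diag3 p q r) = Diag3 p q r"
  by (simp add: Diag3_def transpose_def vec_eq_iff forall_3 vector_3)

text \<open>The four sign vectors form a Klein four-group under componentwise multiplication, and the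
  value of the form at a sign vector is a combination of the trace and of the three doubled mixed
  entries in which the coefficients are the values of the four characters of this group.
  Characters are linearly independent, so all four values vanish only if the trace and every mixed
  entry vanish. The condition at \<open>y\<close> then fixes the diagonal up to a factor, since \<open>(1,1,1)\<close> and
  \<open>(y\<^sub>1\<^sup>2,y\<^sub>2\<^sup>2,y\<^sub>3\<^sup>2)\<close> are linearly independent as soon as two of the squares differ.\<close>

lemma vanishes_at_signs_and_point_iff:
  fixes M :: "real^3^3" and y :: "real^3"
  assumes sym: "transpose M = M" and ne: "(y$1)\<^sup>2 \<noteq> (y$2)\<^sup>2"
  shows "on_conic (vector [1, 1, 1]) M \<and> on_conic (vector [1, -1, 1]) M
      \<and> on_conic (vector [1, 1, -1]) M \<and> on_conic (vector [1, -1, -1]) M \<and> on_conic y M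
    \<longleftrightarrow> (\<exists>k. M = k *\<^sub>R Diag3 ((y$3)\<^sup>2 - (y$2)\<^sup>2) ((y$1)\<^sup>2 - (y$3)\<^sup>2) ((y$2)\<^sup>2 - (y$1)\<^sup>2))"
    (is "?L \<longleftrightarrow> ?R")
proof
  have "M$j$i = M$i$j" for i j
  proof -
    have "M$j$i = transpose M $i$j"
      by (simp add: transpose_def)
    also have "\<dots> = M$i$j"
      by (simp only: sym)
    finally show ?thesis .
  qed
  then have s: "M$2$1 = M$1$2" "M$3$1 = M$1$3" "M$3$2 = M$2$3"
    by this+
  note expand = on_conic_def matrix_vector_mult_def inner_vec_def sum_3 vector_3 s
  assume L: ?L
  then have off: "M$1$2 = 0" "M$1$3 = 0" "M$2$3 = 0" and tr: "M$1$1 + M$2$2 + M$3$3 = 0"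
    by (simp_all add: expand)
  from L have pt: "M$1$1 * (y$1)\<^sup>2 + M$2$2 * (y$2)\<^sup>2 + M$3$3 * (y$3)\<^sup>2 = 0"
    by (simp add: expand off power2_eq_square algebra_simps)
  define k where "k = M$3$3 / ((y$2)\<^sup>2 - (y$1)\<^sup>2)"
  have m3: "M$3$3 = k * ((y$2)\<^sup>2 - (y$1)\<^sup>2)"
    using ne by (simp add: k_def)
  (* Eliminating the second diagonal entry from tr and pt leaves a relation between the first and
     the third, in which the nonzero difference of the first two squares can be cancelled. *)
  have "((y$2)\<^sup>2 - (y$1)\<^sup>2) * M$1$1 = ((y$2)\<^sup>2 - (y$1)\<^sup>2) * (k * ((y$3)\<^sup>2 - (y$2)\<^sup>2))"
    using tr pt m3 by algebra
  then have m1: "M$1$1 = k * ((y$3)\<^sup>2 - (y$2)\<^sup>2)"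
    using ne by simp
  have m2: "M$2$2 = k * ((y$1)\<^sup>2 - (y$3)\<^sup>2)"
    using tr m1 m3 by algebra
  have "M = k *\<^sub>R Diag3 ((y$3)\<^sup>2 - (y$2)\<^sup>2) ((y$1)\<^sup>2 - (y$3)\<^sup>2) ((y$2)\<^sup>2 - (y$1)\<^sup>2)"
    by (simp add: Diag3_def vec_eq_iff forall_3 vector_3 s off m1 m2 m3)
  then show ?R ..
next
  assume ?R
  then obtain k
    where M: "M = k *\<^sub>R Diag3 ((y$3)\<^sup>2 - (y$2)\<^sup>2) ((y$1)\<^sup>2 - (y$3)\<^sup>2) ((y$2)\<^sup>2 - (y$1)\<^sup>2)"
    by blast
  show ?L
    unfolding M on_conic_def
    by (simp add: Diag3_def matrix_vector_mult_def inner_vec_def sum_3 vector_3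
        power2_eq_square algebra_simps)
qed

text \<open>The quadrangle may be replaced by the sign vectors, because its points are nonzero multiples
  of the points with these coordinates.\<close>

lemma on_conic_quadrangle_iff:
  fixes a b c d w y :: "real^3" and A :: "real^3^3"
  defines "E \<equiv> mat_of_cols3 ((a \<times> b) \<times> (c \<times> d)) ((a \<times> c) \<times> (b \<times> d)) ((a \<times> d) \<times> (b \<times> c))"
  assumes ncol: "\<not> proj_collinear {a, b, c}" "\<not> proj_collinear {a, b, d}"
      "\<not> proj_collinear {a, c, d}" "\<not> proj_collinear {b, c, d}"
    and w: "w = E *v y" and ne: "(y$1)\<^sup>2 \<noteq> (y$2)\<^sup>2"
    and sym: "transpose A = A"
  shows "on_conic a A \<and> on_conic b A \<and> on_conic c A \<and> on_conic d A \<and> on_conic w A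
    \<longleftrightarrow> (\<exists>k. transpose E ** A ** E
          = k *\<^sub>R Diag3 ((y$3)\<^sup>2 - (y$2)\<^sup>2) ((y$1)\<^sup>2 - (y$3)\<^sup>2) ((y$2)\<^sup>2 - (y$1)\<^sup>2))"
proof -
  let ?M = "transpose E ** A ** E"
  note nz = ncol[THEN bracket_nonzero_if_not_collinear]
  have "E *v vector [1, 1, 1] = (2 * (a \<bullet> (b \<times> d))) *\<^sub>R c"
    "E *v vector [1, -1, 1] = (- 2 * (b \<bullet> (c \<times> d))) *\<^sub>R a"
    "E *v vector [1, 1, -1] = (2 * (a \<bullet> (c \<times> d))) *\<^sub>R b"
    "E *v vector [1, -1, -1] = (- 2 * (a \<bullet> (b \<times> c))) *\<^sub>R d"
    unfolding E_def mat_of_cols3_mult diagonal_signed_sums[of a b c d, symmetric]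
    by (simp_all add: vector_3)
  then have "on_conic (vector [1, 1, 1]) ?M \<longleftrightarrow> on_conic c A"
    "on_conic (vector [1, -1, 1]) ?M \<longleftrightarrow> on_conic a A"
    "on_conic (vector [1, 1, -1]) ?M \<longleftrightarrow> on_conic b A"
    "on_conic (vector [1, -1, -1]) ?M \<longleftrightarrow> on_conic d A"
    using nz by (simp_all add: on_conic_pullback[symmetric] on_conic_scale del: scaleR_minus_left)
  moreover have "on_conic y ?M \<longleftrightarrow> on_conic w A"
    by (simp add: w on_conic_pullback)
  moreover have "transpose ?M = ?M"
    by (simp add: matrix_transpose_mul sym matrix_mul_assoc)
  ultimately show ?thesis
    using vanishes_at_signs_and_point_iff[of ?M y] ne by blast
qed

section \<open>The conic through five points\<close>

lemma matrix_inv_cancel: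
  fixes A :: "'a::semiring_1^'n^'m"
  assumes "invertible A"
  shows "A ** matrix_inv A = mat 1" "matrix_inv A ** A = mat 1"
  using someI_ex[OF assms[unfolded invertible_def]] by (simp_all add: matrix_inv_def)

lemma congruence_inverse_iff:
  fixes P A D :: "real^'n^'n"
  assumes "invertible P"
  shows "transpose P ** A ** P = D \<longleftrightarrow> A = transpose (matrix_inv P) ** D ** matrix_inv P"
proof -
  let ?Q = "matrix_inv P"
  have PQ: "P ** ?Q = mat 1" "?Q ** P = mat 1"
    using assms by (simp_all add: matrix_inv_cancel)
  have T: "transpose ?Q ** transpose P = mat 1" "transpose P ** transpose ?Q = mat 1"
    unfolding matrix_transpose_mul[symmetric] PQ by (rule transpose_mat)+
  show ?thesis
  proof
    assume "transpose P ** A ** P = D"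
    then have "transpose ?Q ** D ** ?Q = (transpose ?Q ** transpose P) ** A ** (P ** ?Q)"
      by (auto simp: matrix_mul_assoc)
    then show "A = transpose ?Q ** D ** ?Q"
      by (simp add: PQ T)
  next
    assume "A = transpose ?Q ** D ** ?Q"
    then have "transpose P ** A ** P = (transpose P ** transpose ?Q) ** D ** (?Q ** P)"
      by (simp add: matrix_mul_assoc)
    then show "transpose P ** A ** P = D"
      by (simp add: PQ T)
  qed
qed

theorem theorem2:
  fixes x :: "nat \<Rightarrow> real^3"
    and \<xi>\<^sub>1 \<xi>\<^sub>2 \<xi>\<^sub>3 \<beta> :: "real^3"
    and \<Xi> C :: "real^3^3"
  assumes "\<forall>i\<in>{1..5}. finite_point (x i)"
    and "general_position x {1..5}"
    and "\<xi>\<^sub>1 = (x 1 \<times> x 2) \<times> (x 3 \<times> x 4)"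
    and "\<xi>\<^sub>2 = (x 1 \<times> x 3) \<times> (x 2 \<times> x 4)"
    and "\<xi>\<^sub>3 = (x 1 \<times> x 4) \<times> (x 2 \<times> x 3)"
    and "\<Xi> = mat_of_cols3 \<xi>\<^sub>1 \<xi>\<^sub>2 \<xi>\<^sub>3"
    and "\<beta> = matrix_inv \<Xi> *v x 5"
    and "C = transpose (matrix_inv \<Xi>)
           ** Diag3 ((\<beta>$3)\<^sup>2 - (\<beta>$2)\<^sup>2) ((\<beta>$1)\<^sup>2 - (\<beta>$3)\<^sup>2) ((\<beta>$2)\<^sup>2 - (\<beta>$1)\<^sup>2)
           ** matrix_inv \<Xi>"
  shows "invertible \<Xi>
    \<and> is_conic C \<and> nondegenerate C \<and> (\<forall>i\<in>{1..5}. on_conic (x i) C)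
    \<and> (\<forall>A. is_conic A \<and> nondegenerate A \<and> (\<forall>i\<in>{1..5}. on_conic (x i) A) \<longrightarrow> same_conic A C)"
proof -
  define D where "D = Diag3 ((\<beta>$3)\<^sup>2 - (\<beta>$2)\<^sup>2) ((\<beta>$1)\<^sup>2 - (\<beta>$3)\<^sup>2) ((\<beta>$2)\<^sup>2 - (\<beta>$1)\<^sup>2)"
  have C: "C = transpose (matrix_inv \<Xi>) ** D ** matrix_inv \<Xi>"
    using assms(8) by (simp add: D_def)
  note \<Xi> = assms(6)[unfolded assms(3-5)]
  have ncol: "\<not> proj_collinear {x i, x j, x k}"
    if "i \<in> {1..5}" "j \<in> {1..5}" "k \<in> {1..5}" "i \<noteq> j" "i \<noteq> k" "j \<noteq> k" for i j k
    using assms(2) that unfolding general_position_def by blast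
  have inv: "invertible \<Xi>"
    unfolding \<Xi> by (intro diagonal_triangle_invertible ncol) simp_all
  have x5: "x 5 = \<Xi> *v \<beta>"
    using inv by (simp add: assms(7) matrix_vector_mul_assoc matrix_inv_cancel(1))
  note ne = squared_coordinates_distinct[OF x5[unfolded \<Xi>]]
  have distinct: "(\<beta>$1)\<^sup>2 \<noteq> (\<beta>$2)\<^sup>2" "(\<beta>$1)\<^sup>2 \<noteq> (\<beta>$3)\<^sup>2" "(\<beta>$2)\<^sup>2 \<noteq> (\<beta>$3)\<^sup>2"
    by (intro ne ncol; simp)+
  have five: "{1..5} = {1, 2, 3, 4, 5 :: nat}"
    by auto
  have through_iff: "(\<forall>i\<in>{1..5}. on_conic (x i) A) \<longleftrightarrow> (\<exists>k. A = k *\<^sub>R C)"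
    if "transpose A = A" for A
  proof -
    have "(\<forall>i\<in>{1..5}. on_conic (x i) A) \<longleftrightarrow> (\<exists>k. transpose \<Xi> ** A ** \<Xi> = k *\<^sub>R D)"
      unfolding five D_def
      using on_conic_quadrangle_iff[OF _ _ _ _ x5[unfolded \<Xi>] distinct(1) that, folded \<Xi>]
      by (simp add: ncol)
    also have "\<dots> \<longleftrightarrow> (\<exists>k. A = k *\<^sub>R C)"
      unfolding congruence_inverse_iff[OF inv] C
      by (simp add: matrix_scalar_ac scalar_matrix_assoc flip: scalar_mult_eq_scaleR)
    finally show ?thesis .
  qed
  have symC: "transpose C = C"
    by (simp add: C D_def matrix_transpose_mul transpose_Diag3 matrix_mul_assoc)
  have "det (matrix_inv \<Xi>) * det \<Xi> = 1"
    using inv by (metis det_I det_mul matrix_inv_cancel(2))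
  then have "det (matrix_inv \<Xi>) \<noteq> 0"
    by auto
  then have detC: "det C \<noteq> 0"
    using distinct by (simp add: C D_def det_mul det_Diag3)
  then have "C \<noteq> 0"
    by (auto simp: det_3)
  moreover have "\<forall>i\<in>{1..5}. on_conic (x i) C"
    unfolding through_iff[OF symC] by (rule exI[of _ 1]) simp
  moreover have "same_conic A C" if "is_conic A" "\<forall>i\<in>{1..5}. on_conic (x i) A" for A
  proof -
    from that obtain k where "A = k *\<^sub>R C"
      using through_iff by (auto simp: is_conic_def)
    with \<open>is_conic A\<close> show ?thesis
      unfolding same_conic_def is_conic_def by (intro exI[of _ k]) auto
  qed
  ultimately show ?thesis
    using inv symC detC by (auto simp: is_conic_def nondegenerate_def)
qed

end
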